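(* Let $G$ be a connected graph of order $n$ which contains at least one cycle, and let $g$ be its girth. If $G$ is not a cycle, then $$m_G(n-g+3,\,n]\leq n-g.$$
   Context: All graphs are finite and simple. For a graph $G$ with vertices $v_1,\dots,v_n$, the Laplacian matrix is $L(G)=D(G)-A(G)$, where $A(G)$ is the adjacency matrix and $D(G)=\mathrm{diag}(d(v_1),\dots,d(v_n))$ is the diagonal matrix of vertex degrees; its eigenvalues are the Laplacian eigenvalues of $G$ (counted with multiplicity). For an interval $I$ of real numbers, $m_G I$ denotes the number of Laplacian eigenvalues of $G$, counted with multiplicity, lying in $I$. The girth $g$ of $G$ is the length (number of edges) of a shortest cycle in $G$. *)

theory Defs
  imports
    "Graph_Theory.Graph_Theory"
    "Jordan_Normal_Form.Char_Poly"
begin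

text \<open>
  Finite simple graphs are the \<^emph>\<open>pair_graph\<close>s of the Graph_Theory entry: finite loop-free digraphs
  with a symmetric arc relation, an undirected edge \<open>uv\<close> being the two arcs \<open>(u,v)\<close> and \<open>(v,u)\<close>.
  The list \<open>vs\<close> below is an enumeration \<open>v\<^sub>1, \<dots>, v\<^sub>n\<close> of the vertices; out-degree is vertex degree.
\<close>

definition adjacency_matrix :: "'a pair_pre_digraph \<Rightarrow> 'a list \<Rightarrow> real mat" where
  "adjacency_matrix G vs =
     mat (length vs) (length vs) (\<lambda>(i, j). if (vs ! i, vs ! j) \<in> parcs G then 1 else 0)"

definition degree_matrix :: "'a pair_pre_digraph \<Rightarrow> 'a list \<Rightarrow> real mat" where
  "degree_matrix G vs =
     mat_diag (length vs) (\<lambda>i. real (out_degree (with_proj G) (vs ! i)))"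

definition laplacian_matrix :: "'a pair_pre_digraph \<Rightarrow> 'a list \<Rightarrow> real mat" where
  "laplacian_matrix G vs = degree_matrix G vs - adjacency_matrix G vs"

text \<open>
  Eigenvalues with algebraic multiplicity; as the Laplacian matrix is real symmetric, this is the
  whole spectrum and the multiplicities are also the geometric ones.
\<close>

definition laplacian_eigenvalues :: "'a pair_pre_digraph \<Rightarrow> 'a list \<Rightarrow> real multiset" where
  "laplacian_eigenvalues G vs = proots (char_poly (laplacian_matrix G vs))"

definition num_laplacian_eigenvalues ::
    "'a pair_pre_digraph \<Rightarrow> 'a list \<Rightarrow> real set \<Rightarrow> nat" where
  "num_laplacian_eigenvalues G vs I = size {#x \<in># laplacian_eigenvalues G vs. x \<in> I#}"

text \<open>
  \<open>pre_digraph.cycle\<close> also admits the closed walk \<open>u, v, u\<close> along a single undirected edge, which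
  the length condition excludes.
\<close>

definition graph_cycle :: "'a pair_pre_digraph \<Rightarrow> ('a \<times> 'a) awalk \<Rightarrow> bool" where
  "graph_cycle G p \<longleftrightarrow> pre_digraph.cycle (with_proj G) p \<and> 3 \<le> length p"

text \<open>Only meaningful for graphs containing a cycle.\<close>

definition girth :: "'a pair_pre_digraph \<Rightarrow> nat" where
  "girth G = (LEAST k. \<exists>p. graph_cycle G p \<and> length p = k)"

definition is_cycle_graph :: "'a pair_pre_digraph \<Rightarrow> bool" where
  "is_cycle_graph G \<longleftrightarrow>
     (\<exists>p. graph_cycle G p \<and> pverts G = fst ` set p \<and> parcs G = set p \<union> (set p)\<inverse>)"

end

theory Submission
  imports Defs "Jordan_Normal_Form.Jordan_Normal_Form_Existence"
begin

text \<open>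
  If the quadratic form of a real symmetric matrix is at most \<open>t |x|\<^sup>2\<close> on a subspace of codimension
  \<open>k\<close>, then at most \<open>k\<close> eigenvalues exceed \<open>t\<close>. For \<open>g = 3\<close> the interval is empty. For \<open>g \<ge> 4\<close>,
  let \<open>C\<close> be a shortest cycle, which has no chords, and \<open>k = n - g\<close>, which is positive because \<open>G\<close>
  is not a cycle; a subspace of codimension at most \<open>k\<close> on which the Laplacian form is at most
  \<open>(k + 3) |f|\<^sup>2\<close> is found as follows.

  \<^item> If every vertex of \<open>C\<close> has at most \<open>k - 1\<close> neighbours outside \<open>C\<close>, take the functions vanishing
    outside \<open>C\<close>: the cycle contributes at most \<open>4 |f|\<^sup>2\<close> and the remaining edges at most
    \<open>(k - 1) |f|\<^sup>2\<close>.
  \<^item> Otherwise some \<open>a\<close> in \<open>C\<close> is adjacent to every vertex outside \<open>C\<close>. If \<open>g \<ge> 5\<close>, these are all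
    pendant at \<open>a\<close>, and the functions equal to \<open>f a\<close> on all of them only see the cycle.
  \<^item> If \<open>g = 4\<close> in that situation, then \<open>G\<close> is bipartite with one side consisting of \<open>a\<close> and the
    opposite vertex \<open>c\<close> of \<open>C\<close>; the single condition \<open>f a + f c = 0\<close> suffices.
\<close>

section \<open>Eigenvalues of real symmetric matrices\<close>

text \<open>Stacking \<open>cs\<close> as rows and padding with zero rows to a square matrix leaves
  at least one zero row, so the determinant vanishes and the kernel is nontrivial.\<close>

lemma exists_vec_orthogonal_to_list:
  fixes cs :: "'a :: field vec list"
  assumes "length cs < n" and "set cs \<subseteq> carrier_vec n"
  shows "\<exists>v \<in> carrier_vec n. v \<noteq> 0\<^sub>v n \<and> (\<forall>c \<in> set cs. c \<bullet> v = 0)"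
proof -
  define c where "c = (\<lambda>i. if i < length cs then cs ! i else 0\<^sub>v n)"
  define M where "M = mat\<^sub>r n n (\<lambda>i. if i = n - 1 then 0\<^sub>v n else c i)"
  have c: "c \<in> {0..<n} \<rightarrow> carrier_vec n"
    using assms nth_mem by (fastforce simp: c_def)
  have M: "M \<in> carrier_mat n n" by (simp add: M_def)
  have "det M = 0"
    unfolding M_def using assms by (intro det_row_0 c) auto
  then obtain v where v: "v \<in> carrier_vec n" "v \<noteq> 0\<^sub>v n" "M *\<^sub>v v = 0\<^sub>v n"
    using det_0_iff_vec_prod_zero_field[OF M] by blast
  have "cs ! i \<bullet> v = 0" if i: "i < length cs" for i
  proof -
    have "cs ! i \<in> carrier_vec n" using assms i by auto
    then have "row M i = cs ! i"
      using i assms by (intro eq_vecI) (auto simp: M_def c_def)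
    moreover have "(M *\<^sub>v v) $ i = 0" using v i assms by simp
    ultimately show ?thesis using i assms M by simp
  qed
  then have "\<forall>c \<in> set cs. c \<bullet> v = 0" by (metis in_set_conv_nth)
  then show ?thesis using v by blast
qed

section \<open>Diagonalisation of real symmetric matrices\<close>

lemma symmetric_scalar_prod_mult_mat_vec:
  fixes A :: "'a :: comm_semiring_0 mat"
  assumes "A \<in> carrier_mat n n" "transpose_mat A = A" "x \<in> carrier_vec n" "y \<in> carrier_vec n"
  shows "(A *\<^sub>v x) \<bullet> y = x \<bullet> (A *\<^sub>v y)"
  using transpose_vec_mult_scalar[of A n n y x] assms by simp

text \<open>Since \<open>A\<close> is real, conjugating an eigenvector \<open>v\<close> for
  \<open>l\<close> gives one for \<open>cnj l\<close>; moving \<open>A\<close> across the product of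
  \<open>v\<close> with its conjugate by symmetry yields
  \<open>l |v|^2 = cnj l |v|^2\<close>.\<close>

lemma real_symmetric_complex_eigenvalue_real:
  fixes A :: "real mat"
  assumes A: "A \<in> carrier_mat n n" and sym: "transpose_mat A = A"
    and l: "eigenvalue (map_mat complex_of_real A) l"
  shows "l \<in> \<real>"
proof -
  let ?B = "map_mat complex_of_real A"
  have B: "?B \<in> carrier_mat n n" using A by simp
  have symB: "transpose_mat ?B = ?B"
    using sym by (metis map_mat_transpose)
  obtain v where v: "v \<in> carrier_vec n" "v \<noteq> 0\<^sub>v n" "?B *\<^sub>v v = l \<cdot>\<^sub>v v"
    using l B unfolding eigenvalue_def eigenvector_def by auto
  have "conjugate (?B *\<^sub>v v) = ?B *\<^sub>v conjugate v"
    using A v(1) by (intro eq_vecI) (auto simp: scalar_prod_def intro!: sum.cong)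
  then have cv: "?B *\<^sub>v conjugate v = cnj l \<cdot>\<^sub>v conjugate v"
    using v by (simp add: conjugate_smult_vec)
  have "l * (v \<bullet>c v) = (?B *\<^sub>v v) \<bullet>c v" using v by simp
  also have "\<dots> = v \<bullet> (?B *\<^sub>v conjugate v)"
    using symmetric_scalar_prod_mult_mat_vec[OF B symB v(1)] v(1) by simp
  also have "\<dots> = cnj l * (v \<bullet>c v)" using v cv by simp
  finally have "l = cnj l"
    using conjugate_square_eq_0_vec[OF v(1)] v(2) by simp
  then show ?thesis by (simp add: Reals_cnj_iff)
qed

text \<open>The factorisation over the complex numbers has only real roots, so it descends to the
  reals by injectivity of the embedding. It provides the splitting that a real Jordan normal form
  requires.\<close>

lemma real_symmetric_char_poly_splits:
  fixes A :: "real mat"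
  assumes A: "A \<in> carrier_mat n n" and sym: "transpose_mat A = A"
  shows "\<exists>es. char_poly A = (\<Prod>e\<leftarrow>es. [:- e, 1:])"
proof -
  interpret H: map_poly_inj_comm_ring_hom complex_of_real ..
  let ?B = "map_mat complex_of_real A"
  have B: "?B \<in> carrier_mat n n" using A by simp
  obtain as where as: "char_poly ?B = (\<Prod>a\<leftarrow>as. [:- a, 1:])"
    using char_poly_factorized[OF B] by blast
  have "a \<in> \<real>" if "a \<in> set as" for a
  proof -
    have "poly (char_poly ?B) a = 0" 
      using that by (auto simp: as poly_prod_list prod_list_zero_iff)
    then show ?thesis
      using real_symmetric_complex_eigenvalue_real[OF A sym] eigenvalue_root_char_poly[OF B] by blast
  qed
  then have "map (\<lambda>a. complex_of_real (Re a)) as = as"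
    by (simp add: map_idI)
  then have "char_poly ?B = (\<Prod>a\<leftarrow>map (complex_of_real \<circ> Re) as. [:- a, 1:])"
    using as by (simp add: o_def)
  also have "\<dots> = map_poly complex_of_real (\<Prod>e\<leftarrow>map Re as. [:- e, 1:])"
    by (simp add: H.hom_prod_list o_def)
  finally have "map_poly complex_of_real (char_poly A) = map_poly complex_of_real (\<Prod>e\<leftarrow>map Re as. [:- e, 1:])"
    using of_real_hom.char_poly_hom[OF A, where 'a=complex] by simp
  then have "char_poly A = (\<Prod>e\<leftarrow>map Re as. [:- e, 1:])"
    by (rule H.injectivity)
  then show ?thesis by blast
qed

text \<open>A nonzero off-diagonal entry is a superdiagonal 1 inside a single Jordan block, and the
  diagonal of a block is constant.\<close>

lemma jordan_matrix_off_diagonal: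
  assumes "i < sum_list (map fst n_as)" "j < sum_list (map fst n_as)" "i \<noteq> j"
    and "jordan_matrix n_as $$ (i, j) \<noteq> 0"
  shows "j = Suc i \<and> jordan_matrix n_as $$ (i, i) = jordan_matrix n_as $$ (j, j)"
  using assms
proof (induction n_as arbitrary: i j)
  case (Cons na n_as)
  obtain n a where na: "na = (n, a)" by force
  show ?case
  proof (cases "i < n \<or> j < n")
    case True
    then show ?thesis
      using Cons.prems by (auto simp: na jordan_matrix_Cons split: if_splits)
  next
    case False
    then have "j - n = Suc (i - n) \<and>
        jordan_matrix n_as $$ (i - n, i - n) = jordan_matrix n_as $$ (j - n, j - n)"
      using Cons.prems by (intro Cons.IH) (auto simp: na jordan_matrix_Cons)
    then show ?thesis
      using False Cons.prems by (auto simp: na jordan_matrix_Cons)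
  qed
qed simp

text \<open>Symmetry rules out Jordan blocks of size above 1. The matrix \<open>P\<close> obtained
  this way is merely invertible, not necessarily orthogonal.\<close>

lemma real_symmetric_diagonalizable:
  fixes A :: "real mat"
  assumes A: "A \<in> carrier_mat n n" and sym: "transpose_mat A = A"
  shows "\<exists>es P Q. length es = n \<and> char_poly A = (\<Prod>e\<leftarrow>es. [:- e, 1:]) \<and>
    similar_mat_wit A (mat_diag n (\<lambda>i. es ! i)) P Q"
proof -
  obtain n_as where "jordan_nf A n_as"
    using real_symmetric_char_poly_splits[OF A sym] jordan_nf_exists[OF A] by blast
  define J where "J = jordan_matrix n_as"
  obtain P Q where wit: "similar_mat_wit A J P Q"
    using \<open>jordan_nf A n_as\<close> unfolding jordan_nf_def similar_mat_def J_def by blast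
  note PQ = similar_mat_witD2[OF A wit]
  have dim: "sum_list (map fst n_as) = n"
    using carrier_matD(1)[OF PQ(5)] unfolding J_def by simp
  note off = jordan_matrix_off_diagonal[of _ n_as, folded J_def, unfolded dim]
  have "A * P = P * J * (Q * P)"
    using PQ by (simp add: assoc_mult_mat[of _ n n _ n _ n])
  then have AP: "A * P = P * J" using PQ by simp
  have AP_col: "A *\<^sub>v col P j = P *\<^sub>v col J j" if "j < n" for j
    using col_mult2[OF A PQ(6) that] col_mult2[OF PQ(6,5) that] by (simp add: AP)
  have P_unit: "P *\<^sub>v unit_vec n j = col P j" if "j < n" for j
    using that PQ by (intro eq_vecI) auto
  \<comment> \<open>The first nonzero superdiagonal entry would give a Jordan chain \<open>A p = l p\<close>, \<open>A q = l q + c p\<close>;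
    pairing the second equation with \<open>p\<close> yields \<open>c (p \<bullet> p) = 0\<close> by symmetry.\<close>
  have super: "J $$ (j, Suc j) = 0" if "Suc j < n" for j
    using that
  proof (induction j rule: less_induct)
    case (less j)
    show ?case
    proof (rule ccontr)
      assume c: "J $$ (j, Suc j) \<noteq> 0"
      define l where "l = J $$ (j, j)"
      have l: "J $$ (Suc j, Suc j) = l"
        using off[of j "Suc j"] c less.prems by (simp add: l_def)
      \<comment> \<open>By \<open>off\<close> only the entry just above the diagonal could be
        nonzero, and the induction hypothesis excludes it.\<close>
      have "J $$ (i, j) = 0" if "i < n" "i \<noteq> j" for i
        using off[of i j] less that by fastforce
      then have "col J j = l \<cdot>\<^sub>v unit_vec n j"
        using less.prems PQ by (intro eq_vecI) (auto simp: l_def)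
      then have 1: "A *\<^sub>v col P j = l \<cdot>\<^sub>v col P j"
        using AP_col[of j] P_unit[of j] less.prems PQ(6) by (simp add: mult_mat_vec[of _ n n])
      have "J $$ (i, Suc j) = 0" if "i < n" "i \<noteq> j" "i \<noteq> Suc j" for i
        using off[of i "Suc j"] less.prems that by fastforce
      then have "col J (Suc j) = l \<cdot>\<^sub>v unit_vec n (Suc j) + J $$ (j, Suc j) \<cdot>\<^sub>v unit_vec n j"
        using less.prems PQ l by (intro eq_vecI) auto
      then have 2: "A *\<^sub>v col P (Suc j) = l \<cdot>\<^sub>v col P (Suc j) + J $$ (j, Suc j) \<cdot>\<^sub>v col P j"
        using AP_col[of "Suc j"] P_unit[of j] P_unit[of "Suc j"] less.prems PQ(6)
        by (simp add: mult_mat_vec[of _ n n] mult_add_distrib_mat_vec[of _ n n])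
      have p: "col P j \<in> carrier_vec n" "col P (Suc j) \<in> carrier_vec n"
        using PQ less.prems by auto
      have "(A *\<^sub>v col P (Suc j)) \<bullet> col P j = col P (Suc j) \<bullet> (A *\<^sub>v col P j)"
        by (rule symmetric_scalar_prod_mult_mat_vec[OF A sym p(2,1)])
      then have "J $$ (j, Suc j) * (col P j \<bullet> col P j) = 0"
        using p unfolding 1 2 by (simp add: add_scalar_prod_distrib[of _ n])
      then have "col P j = 0\<^sub>v n"
        using c conjugate_square_eq_0_vec[OF p(1)] by simp
      \<comment> \<open>A zero column contradicts the invertibility of \<open>P\<close>, whose
        inverse is \<open>Q\<close>.\<close>
      then have "Q *\<^sub>v (P *\<^sub>v unit_vec n j) = 0\<^sub>v n"
        using P_unit[of j] less.prems PQ by auto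
      moreover have "Q *\<^sub>v (P *\<^sub>v unit_vec n j) = unit_vec n j"
        using PQ assoc_mult_mat_vec[of Q n n P n "unit_vec n j"] by simp
      ultimately have "unit_vec n j $ j = (0\<^sub>v n :: real vec) $ j" by simp
      then show False using less.prems by simp
    qed
  qed
  have off0: "J $$ (i, j) = 0" if "i < n" "j < n" "i \<noteq> j" for i j
    using off[of i j] super[of i] that by fastforce
  define es where "es = diag_mat J"
  have len: "length es = n" using PQ by (simp add: es_def diag_mat_def)
  have diag: "J = mat_diag n (\<lambda>i. es ! i)"
    using PQ off0 by (intro eq_matI) (auto simp: es_def diag_mat_def mat_diag_def)
  have "char_poly A = char_poly J"
    using wit by (intro char_poly_similar) (auto simp: similar_mat_def)
  also have "\<dots> = (\<Prod>e\<leftarrow>es. [:- e, 1:])"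
    unfolding es_def using off0 PQ by (intro char_poly_upper_triangular[of _ n]) auto
  finally show ?thesis using wit len diag by blast
qed

section \<open>Counting eigenvalues above a threshold\<close>

lemma mult_mat_vec_scalar_prod_mult_mat_vec:
  fixes P :: "'a :: comm_semiring_0 mat"
  assumes "P \<in> carrier_mat n n" "u \<in> carrier_vec n" "w \<in> carrier_vec n"
  shows "(P *\<^sub>v u) \<bullet> (P *\<^sub>v w) = (\<Sum>i<n. \<Sum>j<n. u $ i * w $ j * (transpose_mat P * P) $$ (i, j))"
proof -
  have "(P *\<^sub>v u) \<bullet> (P *\<^sub>v w) = (P *\<^sub>v w) \<bullet> (P *\<^sub>v u)"
    using assms by (intro comm_scalar_prod[of _ n]) auto
  also have "\<dots> = (transpose_mat P *\<^sub>v (P *\<^sub>v w)) \<bullet> u"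
    using assms by (subst transpose_vec_mult_scalar[of P n n]) auto
  also have "\<dots> = u \<bullet> ((transpose_mat P * P) *\<^sub>v w)"
    using assms by (subst comm_scalar_prod[of _ n]) (auto simp: assoc_mult_mat_vec[of _ n n _ n])
  also have "\<dots> = (\<Sum>i<n. \<Sum>j<n. u $ i * w $ j * (transpose_mat P * P) $$ (i, j))"
  proof -
    have "u \<bullet> (G *\<^sub>v w) = (\<Sum>i<n. \<Sum>j<n. u $ i * w $ j * G $$ (i, j))"
      if "G \<in> carrier_mat n n" for G
      using assms that by (auto simp: scalar_prod_def lessThan_atLeast0 sum_distrib_left ac_simps
        intro!: sum.cong)
    moreover have "transpose_mat P * P \<in> carrier_mat n n" using assms by simp
    ultimately show ?thesis by blast
  qed
  finally show ?thesis .
qed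

lemma proots_prod_linear_factors:
  "proots (\<Prod>e\<leftarrow>es. [:- e, 1:]) = mset (es :: 'a :: idom list)"
proof (induction es)
  case (Cons e es)
  have "(\<Prod>e\<leftarrow>es. [:- e, 1:]) \<noteq> 0"
    by (auto simp: prod_list_zero_iff)
  then have "proots ([:- e, 1:] * (\<Prod>e\<leftarrow>es. [:- e, 1:])) = {#e#} + mset es"
    by (subst proots_mult) (auto simp: Cons.IH)
  then show ?case by simp
qed simp

text \<open>One half of the min-max principle: with more than \<open>length cs\<close> eigenvalues
  above \<open>t\<close>, the span of their eigenvectors would meet the subspace cut out by
  \<open>cs\<close> in a nonzero vector, where the form exceeds \<open>t |x|^2\<close>.\<close>

lemma real_symmetric_num_eigenvalues_le_codim:
  fixes A :: "real mat"
  assumes A: "A \<in> carrier_mat n n" and sym: "transpose_mat A = A"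
    and cs: "set cs \<subseteq> carrier_vec n"
    and form: "\<And>x. x \<in> carrier_vec n \<Longrightarrow> (\<And>c. c \<in> set cs \<Longrightarrow> c \<bullet> x = 0) \<Longrightarrow>
      x \<bullet> (A *\<^sub>v x) \<le> t * (x \<bullet> x)"
  shows "size {#e \<in># proots (char_poly A). t < e#} \<le> length cs"
proof (rule ccontr)
  assume many: "\<not> ?thesis"
  obtain es P Q where es: "length es = n" "char_poly A = (\<Prod>e\<leftarrow>es. [:- e, 1:])"
    and wit: "similar_mat_wit A (mat_diag n (\<lambda>i. es ! i)) P Q"
    using real_symmetric_diagonalizable[OF A sym] by blast
  define D where "D = mat_diag n (\<lambda>i. es ! i)"
  note PQ = similar_mat_witD2[OF A wit, folded D_def]
  \<comment> \<open>\<open>K\<close> indexes the eigenvalues at most \<open>t\<close>, whose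
    coordinates are to be set to zero.\<close>
  define K where "K = filter (\<lambda>i. \<not> t < es ! i) [0..<n]"
  have "size {#e \<in># proots (char_poly A). t < e#} = length (filter (\<lambda>e. t < e) es)"
    unfolding es(2) proots_prod_linear_factors by (simp flip: mset_filter)
  also have "\<dots> = length (filter (\<lambda>i. t < es ! i) [0..<n])"
    using map_nth[of es] es(1) length_map filter_map
    by (metis (no_types, lifting) comp_apply filter_cong)
  finally have "length K + length cs < n"
    using many sum_length_filter_compl[of "\<lambda>i. t < es ! i" "[0..<n]"] by (simp add: K_def)
  \<comment> \<open>The unknown is the coordinate vector \<open>y\<close> of \<open>x = P y\<close>;
    each constraint \<open>c\<close> on \<open>x\<close> becomes the constraint given by the
    transpose of \<open>P\<close> applied to \<open>c\<close>.\<close>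
  then obtain y where y: "y \<in> carrier_vec n" "y \<noteq> 0\<^sub>v n"
    and yK: "\<And>c. c \<in> set (map (unit_vec n) K @ map (\<lambda>c. transpose_mat P *\<^sub>v c) cs) \<Longrightarrow> c \<bullet> y = 0"
    using exists_vec_orthogonal_to_list[of "map (unit_vec n) K @ map (\<lambda>c. transpose_mat P *\<^sub>v c) cs" n]
      cs PQ(6) by fastforce
  have y0: "y $ i = 0" if "i < n" "\<not> t < es ! i" for i
    using yK[of "unit_vec n i"] that y by (simp add: K_def)
  have yP: "c \<bullet> (P *\<^sub>v y) = 0" if "c \<in> set cs" for c
    using yK[of "transpose_mat P *\<^sub>v c"] that cs PQ(6) y transpose_vec_mult_scalar[of P n n y c]
    by auto
  define G where "G = transpose_mat P * P"
  have "A * P = P * D * (Q * P)"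
    using PQ by (simp add: assoc_mult_mat[of _ n n _ n _ n])
  then have AP: "A * P = P * D" using PQ by simp
  have GD: "G * D = transpose_mat P * (A * P)"
    using PQ unfolding AP G_def by (simp add: assoc_mult_mat[of _ n n _ n _ n])
  \<comment> \<open>Comparing the entries at \<open>(i, j)\<close> and \<open>(j, i)\<close> gives
    \<open>G_ij e_j = G_ij e_i\<close>, which is the dichotomy \<open>orth\<close>.\<close>
  have "transpose_mat (G * D) = G * D"
    using PQ(6) A sym unfolding GD
    by (simp add: transpose_mult[of _ n n _ n] assoc_mult_mat[of _ n n _ n _ n])
  then have "(G * D) $$ (i, j) = (G * D) $$ (j, i)" if "i < n" "j < n" for i j
    using that PQ by (metis G_def carrier_matD index_mult_mat(2,3) index_transpose_mat(1) transpose_carrier_mat)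
  moreover have "(G * D) $$ (i, j) = G $$ (i, j) * es ! j" if "i < n" "j < n" for i j
    using that PQ unfolding D_def by (subst mat_diag_mult_right[of _ n]) (auto simp: G_def)
  moreover have "G $$ (i, j) = G $$ (j, i)" if "i < n" "j < n" for i j
    using that PQ by (simp add: G_def comm_scalar_prod[of _ n])
  ultimately have orth: "es ! i = es ! j \<or> G $$ (i, j) = 0" if "i < n" "j < n" for i j
    using that by (metis mult_cancel_left)
  \<comment> \<open>The columns of \<open>P\<close> need not be orthogonal within an eigenspace. Rescaling the coordinates
    by \<open>sqrt (es ! i - t)\<close> still turns \<open>x \<bullet> A x - t (x \<bullet> x)\<close> into a squared norm, as the
    Gram matrix \<open>G\<close> couples only equal eigenvalues.\<close>
  define z where "z = vec n (\<lambda>i. sqrt (es ! i - t) * y $ i)"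
  have z: "z \<in> carrier_vec n" by (simp add: z_def)
  note expand = mult_mat_vec_scalar_prod_mult_mat_vec[OF PQ(6), folded G_def]
  have term_eq: "z $ i * z $ j * G $$ (i, j) = y $ i * (D *\<^sub>v y) $ j * G $$ (i, j) - t * (y $ i * y $ j * G $$ (i, j))"
    if ij: "i < n" "j < n" for i j
  proof -
    have Dy: "(D *\<^sub>v y) $ j = es ! j * y $ j"
      using ij y by (simp add: D_def mat_diag_def scalar_prod_def if_distrib[of "\<lambda>x. x * _"] cong: if_cong)
    consider "G $$ (i, j) = 0" | "\<not> t < es ! i" | "t < es ! i" "es ! i = es ! j" using orth ij by blast
    then show ?thesis
    proof cases
      \<comment> \<open>Here \<open>y $ i = 0\<close>, so both sides vanish whatever the sign under
        the root.\<close>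
      case 2
      then show ?thesis using y0[of i] ij by (simp add: z_def)
    next
      case 3
      then have "sqrt (es ! i - t) * sqrt (es ! j - t) = es ! j - t" by simp
      moreover have "z $ i * z $ j = sqrt (es ! i - t) * sqrt (es ! j - t) * (y $ i * y $ j)"
        using ij by (simp add: z_def)
      ultimately have zz: "z $ i * z $ j = (es ! j - t) * (y $ i * y $ j)" by simp
      show ?thesis unfolding zz Dy by (simp add: algebra_simps)
    qed simp
  qed
  have "A *\<^sub>v (P *\<^sub>v y) = P *\<^sub>v (D *\<^sub>v y)"
    using AP A PQ y by (metis assoc_mult_mat_vec)
  then have "(P *\<^sub>v z) \<bullet> (P *\<^sub>v z) = (P *\<^sub>v y) \<bullet> (A *\<^sub>v (P *\<^sub>v y)) - t * ((P *\<^sub>v y) \<bullet> (P *\<^sub>v y))"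
    using y z PQ(5) by (simp add: expand term_eq sum_subtractf sum_distrib_left)
  also have "\<dots> \<le> 0"
    using form[of "P *\<^sub>v y"] yP y PQ(6) by simp
  finally have "(P *\<^sub>v z) \<bullet> (P *\<^sub>v z) \<le> 0" .
  moreover have Pz: "P *\<^sub>v z \<in> carrier_vec n" using PQ(6) z by simp
  ultimately have "P *\<^sub>v z = 0\<^sub>v n"
    using conjugate_square_eq_0_vec[OF Pz] conjugate_square_ge_0_vec[of "P *\<^sub>v z"] by simp
  then have "Q *\<^sub>v (P *\<^sub>v z) = 0\<^sub>v n" using PQ(7) by auto
  then have "z = 0\<^sub>v n"
    using PQ z assoc_mult_mat_vec[of Q n n P n z] by simp
  \<comment> \<open>Where \<open>es ! i > t\<close> the scaling factor is positive, so
    \<open>z $ i = 0\<close> gives the claim; elsewhere it is \<open>y0\<close>.\<close>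
  have "y $ i = 0" if "i < n" for i
    using arg_cong[OF \<open>z = 0\<^sub>v n\<close>, of "\<lambda>v. v $ i"] y0[of i] that by (auto simp: z_def)
  then show False using y by auto
qed

section \<open>The Laplacian quadratic form\<close>

text \<open>The factor 1/2 compensates for each undirected edge being two arcs.\<close>

definition laplacian_form :: "'a pair_pre_digraph \<Rightarrow> ('a \<Rightarrow> real) \<Rightarrow> real" where
  "laplacian_form G f = (\<Sum>(u, v)\<in>parcs G. (f u - f v)\<^sup>2) / 2"

definition nbrs :: "'a pair_pre_digraph \<Rightarrow> 'a \<Rightarrow> 'a set" where
  "nbrs G u = {v. (u, v) \<in> parcs G}"

lemma sum_nth_distinct:
  assumes "distinct xs"
  shows "(\<Sum>i<length xs. h (xs ! i)) = sum h (set xs)"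
  using assms sum.reindex_bij_betw[OF bij_betw_nth[OF assms refl refl], of h] by simp

context pair_graph
begin

lemma nbrs_subset: "nbrs G u \<subseteq> pverts G"
  by (auto simp: nbrs_def dest: in_arcsD2)

lemma finite_nbrs [simp]: "finite (nbrs G u)"
  using nbrs_subset pair_finite_verts by (rule finite_subset)

lemma arc_commute: "(u, v) \<in> parcs G \<longleftrightarrow> (v, u) \<in> parcs G"
  using arcs_symmetric by blast

lemma parcs_Sigma: "parcs G = Sigma (pverts G) (nbrs G)"
  by (auto simp: nbrs_def dest: in_arcsD1)

lemma sum_parcs: "sum h (parcs G) = (\<Sum>u\<in>pverts G. \<Sum>v\<in>nbrs G u. h (u, v))"
  unfolding parcs_Sigma using pair_finite_verts by (simp add: sum.Sigma)

lemma sum_parcs_swap: "(\<Sum>(u, v)\<in>parcs G. h v u) = (\<Sum>(u, v)\<in>parcs G. h u v)"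
  by (rule sum.reindex_bij_witness[of _ prod.swap prod.swap]) (auto dest: arcs_symmetric)

lemma out_degree_eq_card_nbrs: "out_degree (with_proj G) u = card (nbrs G u)"
proof -
  have "out_arcs (with_proj G) u = Pair u ` nbrs G u"
    by (auto simp: out_arcs_def nbrs_def)
  then show ?thesis
    by (simp add: out_degree_def card_image inj_on_def)
qed

lemma laplacian_form_eq:
  "laplacian_form G f =
    (\<Sum>u\<in>pverts G. real (card (nbrs G u)) * (f u)\<^sup>2 - (\<Sum>v\<in>nbrs G u. f u * f v))"
proof -
  have "2 * laplacian_form G f = (\<Sum>(u, v)\<in>parcs G. (f u)\<^sup>2 + (f v)\<^sup>2 - 2 * (f u * f v))"
    by (simp add: laplacian_form_def power2_diff mult.assoc)
  also have "\<dots> =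
      (\<Sum>(u, v)\<in>parcs G. (f u)\<^sup>2) + (\<Sum>(u, v)\<in>parcs G. (f v)\<^sup>2) - 2 * (\<Sum>(u, v)\<in>parcs G. f u * f v)"
    by (simp add: case_prod_unfold sum.distrib sum_subtractf sum_distrib_left)
  also have "(\<Sum>(u, v)\<in>parcs G. (f v)\<^sup>2) = (\<Sum>(u, v)\<in>parcs G. (f u)\<^sup>2)"
    by (rule sum_parcs_swap)
  finally show ?thesis
    by (simp add: sum_parcs sum_subtractf)
qed

text \<open>A discharging scheme: \<open>w u v\<close> is the share of the cost of the edge
  \<open>uv\<close> that is paid by \<open>u\<close>. Bounds on the form can then be checked vertex
  by vertex.\<close>

lemma laplacian_form_le:
  assumes "\<And>u v. (u, v) \<in> parcs G \<Longrightarrow> (f u - f v)\<^sup>2 \<le> w u v + w v u"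
  shows "laplacian_form G f \<le> (\<Sum>u\<in>pverts G. \<Sum>v\<in>nbrs G u. w u v)"
proof -
  have "2 * laplacian_form G f \<le> (\<Sum>(u, v)\<in>parcs G. w u v + w v u)"
    unfolding laplacian_form_def using assms by (auto intro: sum_mono)
  also have "\<dots> = (\<Sum>(u, v)\<in>parcs G. w u v) + (\<Sum>(u, v)\<in>parcs G. w v u)"
    by (simp add: case_prod_unfold sum.distrib)
  also have "\<dots> = 2 * (\<Sum>(u, v)\<in>parcs G. w u v)"
    unfolding sum_parcs_swap[of w] by simp
  finally show ?thesis by (simp add: sum_parcs)
qed

section \<open>From the Laplacian matrix to functions on vertices\<close>

lemma laplacian_matrix_carrier: "laplacian_matrix G vs \<in> carrier_mat (length vs) (length vs)"
  unfolding laplacian_matrix_def adjacency_matrix_def by (intro minus_carrier_mat) simp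

lemma laplacian_matrix_index:
  assumes "i < length vs" "j < length vs"
  shows "laplacian_matrix G vs $$ (i, j) =
    (if i = j then real (card (nbrs G (vs ! i))) else 0) - (if vs ! j \<in> nbrs G (vs ! i) then 1 else 0)"
  using assms
  by (simp add: laplacian_matrix_def adjacency_matrix_def degree_matrix_def mat_diag_def
    out_degree_eq_card_nbrs nbrs_def)

lemma laplacian_matrix_symmetric: "transpose_mat (laplacian_matrix G vs) = laplacian_matrix G vs"
proof (rule eq_matI)
  fix i j assume ij: "i < dim_row (laplacian_matrix G vs)" "j < dim_col (laplacian_matrix G vs)"
  then have "i < length vs" "j < length vs" using laplacian_matrix_carrier[of vs] by auto
  then have "laplacian_matrix G vs $$ (j, i) = laplacian_matrix G vs $$ (i, j)"
    using arc_commute[of "vs ! i" "vs ! j"] by (simp add: laplacian_matrix_index nbrs_def)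
  then show "transpose_mat (laplacian_matrix G vs) $$ (i, j) = laplacian_matrix G vs $$ (i, j)"
    using ij laplacian_matrix_carrier[of vs] by simp
qed (use laplacian_matrix_carrier[of vs] in auto)

lemma laplacian_matrix_quadratic_form:
  assumes vs: "distinct vs" "set vs = pverts G"
    and x: "x \<in> carrier_vec (length vs)" "\<And>i. i < length vs \<Longrightarrow> x $ i = f (vs ! i)"
  shows "x \<bullet> (laplacian_matrix G vs *\<^sub>v x) = laplacian_form G f"
proof -
  let ?n = "length vs"
  have row: "(laplacian_matrix G vs *\<^sub>v x) $ i =
      real (card (nbrs G (vs ! i))) * f (vs ! i) - (\<Sum>v\<in>nbrs G (vs ! i). f v)" if i: "i < ?n" for i
  proof -
    have "(laplacian_matrix G vs *\<^sub>v x) $ i = (\<Sum>j<?n. laplacian_matrix G vs $$ (i, j) * f (vs ! j))"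
      using i x laplacian_matrix_carrier[of vs]
      by (auto simp: scalar_prod_def lessThan_atLeast0 intro!: sum.cong)
    also have "\<dots> = (\<Sum>j<?n. if i = j then real (card (nbrs G (vs ! i))) * f (vs ! j) else 0)
        - (\<Sum>j<?n. if vs ! j \<in> nbrs G (vs ! i) then f (vs ! j) else 0)"
      unfolding sum_subtractf[symmetric] using i
      by (intro sum.cong) (auto simp: laplacian_matrix_index left_diff_distrib)
    also have "(\<Sum>j<?n. if vs ! j \<in> nbrs G (vs ! i) then f (vs ! j) else 0)
        = (\<Sum>v\<in>pverts G. if v \<in> nbrs G (vs ! i) then f v else 0)"
      using sum_nth_distinct[OF vs(1), of "\<lambda>v. if v \<in> nbrs G (vs ! i) then f v else 0"] vs by simp
    also have "\<dots> = (\<Sum>v\<in>nbrs G (vs ! i). f v)"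
      using nbrs_subset[of "vs ! i"] pair_finite_verts
      by (simp add: sum.inter_restrict[symmetric] Int_absorb1)
    finally show ?thesis using i by simp
  qed
  have "x \<bullet> (laplacian_matrix G vs *\<^sub>v x) =
      (\<Sum>i<?n. f (vs ! i) * (real (card (nbrs G (vs ! i))) * f (vs ! i) - (\<Sum>v\<in>nbrs G (vs ! i). f v)))"
    using x row laplacian_matrix_carrier[of vs]
    by (auto simp: scalar_prod_def[of x] lessThan_atLeast0 simp del: index_mult_mat_vec intro!: sum.cong)
  also have "\<dots> = (\<Sum>u\<in>pverts G. f u * (real (card (nbrs G u)) * f u - (\<Sum>v\<in>nbrs G u. f v)))"
    using sum_nth_distinct[OF vs(1)] vs by simp
  also have "\<dots> = laplacian_form G f"
    unfolding laplacian_form_eq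
    by (intro sum.cong) (auto simp: algebra_simps power2_eq_square sum_distrib_left)
  finally show ?thesis .
qed

text \<open>Transfers the codimension bound from coordinate vectors to functions on vertices;
  \<open>cs\<close> lists the coefficient functions of the linear conditions.\<close>

lemma num_laplacian_eigenvalues_le_codim:
  assumes vs: "distinct vs" "set vs = pverts G"
    and form: "\<And>f. (\<And>c. c \<in> set cs \<Longrightarrow> (\<Sum>v\<in>pverts G. c v * f v) = 0) \<Longrightarrow>
      laplacian_form G f \<le> t * (\<Sum>v\<in>pverts G. (f v)\<^sup>2)"
  shows "num_laplacian_eigenvalues G vs {t<..b} \<le> length cs"
proof -
  let ?n = "length vs"
  let ?L = "laplacian_matrix G vs"
  define cs' where "cs' = map (\<lambda>c. vec ?n (\<lambda>i. c (vs ! i))) cs"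
  have "size {#e \<in># proots (char_poly ?L). t < e#} \<le> length cs'"
  proof (rule real_symmetric_num_eigenvalues_le_codim[OF laplacian_matrix_carrier laplacian_matrix_symmetric])
    show "set cs' \<subseteq> carrier_vec ?n" by (auto simp: cs'_def)
    fix x assume x: "x \<in> carrier_vec ?n" and orth: "\<And>c. c \<in> set cs' \<Longrightarrow> c \<bullet> x = 0"
    \<comment> \<open>Reads off the coordinate at the position of \<open>v\<close> in
      \<open>vs\<close>, which is unique by distinctness.\<close>
    define f where "f = (\<lambda>v. x $ inv_into {..<?n} (\<lambda>i. vs ! i) v)"
    have f: "x $ i = f (vs ! i)" if "i < ?n" for i
      using that vs(1) by (simp add: f_def inv_into_f_f inj_on_nth)
    have sp: "y \<bullet> x = (\<Sum>v\<in>pverts G. c v * f v)"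
      if "\<And>i. i < ?n \<Longrightarrow> y $ i = c (vs ! i)" for c y
      using that x f sum_nth_distinct[OF vs(1), of "\<lambda>v. c v * f v"] vs(2)
      by (simp add: scalar_prod_def lessThan_atLeast0)
    have "laplacian_form G f \<le> t * (\<Sum>v\<in>pverts G. (f v)\<^sup>2)"
    proof (rule form)
      fix c assume "c \<in> set cs"
      then have "vec ?n (\<lambda>i. c (vs ! i)) \<bullet> x = 0" by (intro orth) (auto simp: cs'_def)
      then show "(\<Sum>v\<in>pverts G. c v * f v) = 0" using sp[of _ c] by simp
    qed
    then show "x \<bullet> (?L *\<^sub>v x) \<le> t * (x \<bullet> x)"
      using laplacian_matrix_quadratic_form[OF vs x f] sp[OF f] by (simp add: power2_eq_square)
  qed
  moreover have "{#e \<in># proots (char_poly ?L). e \<in> {t<..b}#} =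
      {#e \<in># {#e \<in># proots (char_poly ?L). t < e#}. e \<le> b#}"
    by (simp add: filter_filter_mset)
  then have "size {#e \<in># proots (char_poly ?L). e \<in> {t<..b}#} \<le> size {#e \<in># proots (char_poly ?L). t < e#}"
    by (metis size_filter_mset_lesseq)
  ultimately show ?thesis
    by (simp add: num_laplacian_eigenvalues_def laplacian_eigenvalues_def cs'_def)
qed

end

section \<open>Shortest cycles\<close>

text \<open>Encodes a cycle by its vertices with the start not repeated, which is convenient for
  rotating and splicing; appending \<open>hd xs\<close> accounts for the closing edge.\<close>

definition cyclic_list :: "'a pair_pre_digraph \<Rightarrow> 'a list \<Rightarrow> bool" where
  "cyclic_list G xs \<longleftrightarrow> 3 \<le> length xs \<and> distinct xs \<and>
     successively (\<lambda>u v. (u, v) \<in> parcs G) (xs @ [hd xs])"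

text \<open>The zip pairs consecutive vertices of the sequence \<open>u # ys @ [v]\<close>, that is,
  it lists the arcs of that walk.\<close>

lemma pcas_zip: "pcas u (zip (u # ys) (ys @ [v])) v"
  by (induction ys arbitrary: u) auto

lemma pcas_imp_zip:
  assumes "pcas u p v" "p \<noteq> []"
  shows "\<exists>ys. p = zip (u # ys) (ys @ [v])"
  using assms
proof (induction p arbitrary: u)
  case (Cons e p)
  show ?case
  proof (cases "p = []")
    case True
    with Cons.prems show ?thesis by (intro exI[of _ "[]"]) (auto simp: prod_eq_iff)
  next
    case False
    then obtain ys where "p = zip (snd e # ys) (ys @ [v])"
      using Cons by auto
    with Cons.prems show ?thesis by (intro exI[of _ "snd e # ys"]) (auto simp: prod_eq_iff)
  qed
qed simp

lemma pawalk_verts_zip: "pawalk_verts u (zip (u # ys) (ys @ [v])) = u # ys @ [v]"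
  by (induction ys arbitrary: u) auto

lemma set_zip_subset_iff_successively:
  "set (zip (u # ys) (ys @ [v])) \<subseteq> R \<longleftrightarrow> successively (\<lambda>a b. (a, b) \<in> R) (u # ys @ [v])"
  by (induction ys arbitrary: u) auto

lemma cyclic_list_Cons:
  "cyclic_list G (u # ys) \<longleftrightarrow>
    2 \<le> length ys \<and> distinct (u # ys) \<and> set (zip (u # ys) (ys @ [u])) \<subseteq> parcs G"
  unfolding set_zip_subset_iff_successively by (auto simp: cyclic_list_def)

lemma cyclic_list_rotate:
  assumes "cyclic_list G (ys @ v # zs)"
  shows "cyclic_list G (v # zs @ ys)"
  using assms unfolding cyclic_list_def
  by (cases ys) (auto simp: successively_append_iff successively_Cons hd_append split: if_splits)

text \<open>Both zips consist of the arcs from \<open>a\<close> to \<open>b\<close> and those from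
  \<open>b\<close> back to \<open>a\<close>, only in the opposite order.\<close>

lemma set_zip_rotate:
  "set (zip (a # cs @ b # bs) (cs @ b # bs @ [a])) = set (zip (b # bs @ a # cs) (bs @ a # cs @ [b]))"
  using zip_append[of "a # cs" "cs @ [b]" "b # bs" "bs @ [a]"]
    zip_append[of "b # bs" "bs @ [a]" "a # cs" "cs @ [b]"] by auto

context pair_graph
begin

lemma graph_cycle_iff:
  "graph_cycle G p \<longleftrightarrow> (\<exists>u ys. p = zip (u # ys) (ys @ [u]) \<and> cyclic_list G (u # ys))"
proof
  assume "graph_cycle G p"
  then obtain u where u: "u \<in> pverts G" "set p \<subseteq> parcs G" "pcas u p u" "p \<noteq> []"
    "distinct (tl (pawalk_verts u p))" "3 \<le> length p"
    by (auto simp: graph_cycle_def cycle_def awalk_def)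
  from pcas_imp_zip[OF u(3,4)] obtain ys where p: "p = zip (u # ys) (ys @ [u])" ..
  have "cyclic_list G (u # ys)"
    using u(2,5,6) unfolding p pawalk_verts_zip cyclic_list_Cons by auto
  with p show "\<exists>u ys. p = zip (u # ys) (ys @ [u]) \<and> cyclic_list G (u # ys)" by blast
next
  assume "\<exists>u ys. p = zip (u # ys) (ys @ [u]) \<and> cyclic_list G (u # ys)"
  then obtain u ys where p: "p = zip (u # ys) (ys @ [u])" and c: "cyclic_list G (u # ys)" by blast
  have arcs: "set p \<subseteq> parcs G" using c unfolding cyclic_list_Cons p by blast
  have ne: "p \<noteq> []" using c by (cases ys) (auto simp: p)
  have "hd p \<in> parcs G" using arcs ne by auto
  then have "fst (hd p) \<in> pverts G" by (rule arc_fst_in_verts)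
  then have "u \<in> pverts G" by (cases ys) (auto simp: p)
  moreover have "pcas u p u" unfolding p by (rule pcas_zip)
  moreover have "distinct (tl (pawalk_verts u p))"
    using c unfolding p pawalk_verts_zip cyclic_list_Cons by auto
  moreover have "3 \<le> length p"
    using c unfolding p cyclic_list_Cons by auto
  ultimately show "graph_cycle G p"
    using arcs ne by (auto simp: graph_cycle_def cycle_def awalk_def)
qed

lemma girth_le:
  assumes "cyclic_list G xs"
  shows "girth G \<le> length xs"
proof -
  obtain u ys where xs: "xs = u # ys"
    using assms by (cases xs) (auto simp: cyclic_list_def)
  then have "graph_cycle G (zip (u # ys) (ys @ [u]))"
    using assms by (auto simp: graph_cycle_iff)
  then show ?thesis
    unfolding girth_def by (intro Least_le) (auto simp: xs intro!: exI)
qed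

lemma exists_shortest_cyclic_list:
  assumes "\<exists>p. graph_cycle G p"
  shows "\<exists>xs. cyclic_list G xs \<and> length xs = girth G"
proof -
  have "\<exists>k p. graph_cycle G p \<and> length p = k" using assms by blast
  then have "\<exists>p. graph_cycle G p \<and> length p = girth G"
    unfolding girth_def by (rule LeastI_ex)
  then obtain u ys where "cyclic_list G (u # ys)" "length (zip (u # ys) (ys @ [u])) = girth G"
    unfolding graph_cycle_iff by blast
  then show ?thesis by (intro exI[of _ "u # ys"]) simp
qed

lemma cyclic_list_verts:
  assumes "cyclic_list G xs"
  shows "set xs \<subseteq> pverts G"
proof
  fix v assume "v \<in> set xs"
  then obtain ys zs where "xs = ys @ v # zs" by (auto simp: in_set_conv_decomp)
  then have "cyclic_list G (v # zs @ ys)" using assms cyclic_list_rotate by auto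
  then show "v \<in> pverts G"
    by (cases "zs @ ys") (auto simp: cyclic_list_Cons dest: in_arcsD1)
qed

section \<open>Consequences of minimal cycle length\<close>

lemma no_triangle:
  assumes "4 \<le> girth G" "(a, b) \<in> parcs G" "(b, c) \<in> parcs G"
  shows "(a, c) \<notin> parcs G"
proof
  assume "(a, c) \<in> parcs G"
  then have "cyclic_list G [a, b, c]"
    using assms by (auto simp: cyclic_list_def arcs_symmetric dest: no_loops')
  then show False using girth_le assms by fastforce
qed

text \<open>A chord \<open>vw\<close> would close the stretch from \<open>v\<close> to
  \<open>w\<close> to a cycle avoiding the nonempty stretch behind \<open>w\<close>, hence to a
  shorter one.\<close>

lemma shortest_cycle_chordless:
  assumes c: "cyclic_list G (v # ws)" "length (v # ws) = girth G"
    and w: "w \<in> set ws" "(v, w) \<in> parcs G"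
  shows "w = hd ws \<or> w = last ws"
proof (rule ccontr)
  assume neg: "\<not> ?thesis"
  obtain as bs where ws: "ws = as @ w # bs" using w(1) by (auto simp: in_set_conv_decomp)
  with neg have ne: "as \<noteq> []" "bs \<noteq> []" by auto
  have "cyclic_list G (v # as @ [w])"
    using c(1) w(2) ne(1) arcs_symmetric[OF w(2)]
    by (auto simp: cyclic_list_def ws successively_append_iff successively_Cons Suc_le_eq)
  then have "girth G \<le> length (v # as @ [w])" by (rule girth_le)
  then show False using c(2) ne(2) by (cases bs) (auto simp: ws)
qed

text \<open>The detour through \<open>u\<close> closes each of the two stretches between
  \<open>v\<close> and \<open>w\<close> to a cycle, of lengths \<open>length as + 3\<close> and
  \<open>length bs + 3\<close>, while the girth is \<open>length as + length bs + 2\<close>.\<close>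

lemma two_nbrs_on_shortest_cycle:
  assumes c: "cyclic_list G (v # ws)" "length (v # ws) = girth G"
    and u: "u \<notin> set (v # ws)" "(u, v) \<in> parcs G" "(u, w) \<in> parcs G" and w: "w \<in> set ws"
  shows "\<exists>as bs. ws = as @ w # bs \<and> length as \<le> 1 \<and> length bs \<le> 1"
proof -
  obtain as bs where ws: "ws = as @ w # bs" using w by (auto simp: in_set_conv_decomp)
  have "cyclic_list G (u # v # as @ [w])" "cyclic_list G (u # w # bs @ [v])"
    using c(1) u arcs_symmetric[OF u(2)] arcs_symmetric[OF u(3)]
    by (auto simp: cyclic_list_def ws successively_append_iff successively_Cons hd_append
      split: if_splits)
  from this[THEN girth_le] have "girth G \<le> length as + 3" "girth G \<le> length bs + 3"
    by simp_all
  then show ?thesis using c(2) ws by (intro exI[of _ as] exI[of _ bs]) auto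
qed

text \<open>Rotating any vertex to the front and applying chordlessness shows that every arc joins
  cyclically consecutive vertices.\<close>

lemma spanning_shortest_cycle_imp_cycle_graph:
  assumes c: "cyclic_list G xs" "length xs = girth G" "set xs = pverts G"
  shows "is_cycle_graph G"
proof -
  obtain u ys where xs: "xs = u # ys"
    using c(1) by (cases xs) (auto simp: cyclic_list_def)
  define p where "p = zip (u # ys) (ys @ [u])"
  have p: "graph_cycle G p" "set p \<subseteq> parcs G"
    using c(1) by (auto simp: graph_cycle_iff p_def xs cyclic_list_Cons)
  have "fst ` set p = set (map fst p)" by simp
  also have "\<dots> = set xs" unfolding p_def xs by (subst map_fst_zip) auto
  finally have verts: "pverts G = fst ` set p" using c(3) by simp
  have "(a, b) \<in> set p \<union> (set p)\<inverse>" if ab: "(a, b) \<in> parcs G" for a b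
  proof -
    have mem: "a \<in> set xs" "b \<in> set xs" "a \<noteq> b"
      using ab c(3) by (auto dest: in_arcsD1 in_arcsD2 no_loops')
    then obtain bs cs where bcs: "xs = bs @ a # cs" by (auto simp: in_set_conv_decomp)
    have rot: "set (zip (a # cs @ bs) ((cs @ bs) @ [a])) \<subseteq> set p"
      using bcs set_zip_rotate[of a cs] unfolding p_def xs by (cases bs) auto
    have "cyclic_list G (a # cs @ bs)" using c(1) bcs cyclic_list_rotate by auto
    then have "b = hd (cs @ bs) \<or> b = last (cs @ bs)"
      using c(2) bcs ab mem by (intro shortest_cycle_chordless[of a]) auto
    moreover have ne: "cs @ bs \<noteq> []" using mem bcs by auto
    have "(a, hd (cs @ bs)) \<in> set (zip (a # cs @ bs) ((cs @ bs) @ [a]))"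
      using ne by (cases "cs @ bs") auto
    moreover have "(last (cs @ bs), a) \<in> set (zip (a # cs @ bs) ((cs @ bs) @ [a]))"
    proof -
      obtain ds d where "cs @ bs = ds @ [d]" using ne by (metis rev_exhaust)
      then show ?thesis using zip_append[of "a # ds" "ds @ [d]" "[d]" "[a]"] by simp
    qed
    ultimately show ?thesis using rot by auto
  qed
  then have "parcs G = set p \<union> (set p)\<inverse>"
    using p(2) arcs_symmetric by auto
  then show ?thesis using p(1) verts unfolding is_cycle_graph_def by blast
qed

end

section \<open>Subspaces of small Laplacian form\<close>

lemma diff_square_le: "(x - y :: real)\<^sup>2 \<le> 2 * x\<^sup>2 + 2 * y\<^sup>2"
  using zero_le_power2[of "x + y"] by (simp add: power2_eq_square algebra_simps)

context pair_graph
begin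

lemma card_nbrs_on_shortest_cycle:
  assumes c: "cyclic_list G xs" "length xs = girth G" and v: "v \<in> set xs"
  shows "card (nbrs G v \<inter> set xs) \<le> 2"
proof -
  obtain ys zs where xs: "xs = ys @ v # zs" using v by (auto simp: in_set_conv_decomp)
  have "w \<in> {hd (zs @ ys), last (zs @ ys)}" if "w \<in> nbrs G v \<inter> set xs" for w
    using shortest_cycle_chordless[of v "zs @ ys" w] that c cyclic_list_rotate[of G ys v zs]
    by (auto simp: xs nbrs_def dest: no_loops')
  then have "nbrs G v \<inter> set xs \<subseteq> {hd (zs @ ys), last (zs @ ys)}" by blast
  then have "card (nbrs G v \<inter> set xs) \<le> card {hd (zs @ ys), last (zs @ ys)}"
    by (intro card_mono) auto
  also have "\<dots> \<le> 2" by (simp add: card_insert_if)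
  finally show ?thesis .
qed

text \<open>For \<open>f\<close> vanishing outside \<open>C\<close>, an edge inside \<open>C\<close>
  charges \<open>2 (f u)^2\<close> to each end and an edge leaving \<open>C\<close> charges
  \<open>(f u)^2\<close> to its end in \<open>C\<close>. With \<open>k\<close> outer vertices,
  \<open>u\<close> pays at most \<open>4 + (k - 1)\<close> times \<open>(f u)^2\<close>.\<close>

lemma num_laplacian_eigenvalues_le_if_few_outer_nbrs:
  assumes vs: "distinct vs" "set vs = pverts G"
    and C: "C \<subseteq> pverts G" "\<And>v. v \<in> C \<Longrightarrow> card (nbrs G v \<inter> C) \<le> 2"
    and out: "\<And>v. v \<in> C \<Longrightarrow> card (nbrs G v - C) < card (pverts G - C)"
  shows "num_laplacian_eigenvalues G vs {real (card (pverts G - C)) + 3<..b} \<le> card (pverts G - C)"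
proof -
  let ?k = "card (pverts G - C)"
  obtain us where us: "set us = pverts G - C" "distinct us"
    using finite_distinct_list pair_finite_verts by (meson finite_Diff)
  have "num_laplacian_eigenvalues G vs {real ?k + 3<..b}
      \<le> length (map (\<lambda>u v. of_bool (v = u) :: real) us)"
  proof (rule num_laplacian_eigenvalues_le_codim[OF vs])
    fix f :: "'a \<Rightarrow> real"
    assume orth: "\<And>c. c \<in> set (map (\<lambda>u v. of_bool (v = u)) us) \<Longrightarrow> (\<Sum>v\<in>pverts G. c v * f v) = 0"
    have f0: "f u = 0" if "u \<in> pverts G" "u \<notin> C" for u
      using orth[of "\<lambda>v. of_bool (v = u)"] that us pair_finite_verts
      by (auto simp: of_bool_def if_distrib[of "\<lambda>x. x * _"] cong: if_cong)
    define w where "w = (\<lambda>u v. if u \<in> C then (if v \<in> C then 2 * (f u)\<^sup>2 else (f u)\<^sup>2) else 0)"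
    have "laplacian_form G f \<le> (\<Sum>u\<in>pverts G. \<Sum>v\<in>nbrs G u. w u v)"
    proof (rule laplacian_form_le)
      fix u v assume "(u, v) \<in> parcs G"
      then have "u \<in> pverts G" "v \<in> pverts G" by (auto dest: in_arcsD1 in_arcsD2)
      then show "(f u - f v)\<^sup>2 \<le> w u v + w v u"
        using f0[of u] f0[of v] diff_square_le[of "f u" "f v"] by (auto simp: w_def)
    qed
    also have "\<dots> \<le> (\<Sum>u\<in>pverts G. (real ?k + 3) * (f u)\<^sup>2)"
    proof (rule sum_mono)
      fix u assume "u \<in> pverts G"
      show "(\<Sum>v\<in>nbrs G u. w u v) \<le> (real ?k + 3) * (f u)\<^sup>2"
      proof (cases "u \<in> C")
        case True
        have "(\<Sum>v\<in>nbrs G u. w u v) = (\<Sum>v\<in>nbrs G u \<inter> C. w u v) + (\<Sum>v\<in>nbrs G u - C. w u v)"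
          by (rule sum.Int_Diff) simp
        also have "\<dots> = (real (2 * card (nbrs G u \<inter> C) + card (nbrs G u - C))) * (f u)\<^sup>2"
          using True by (simp add: w_def algebra_simps)
        also have "\<dots> \<le> (real ?k + 3) * (f u)\<^sup>2"
          using C(2)[OF True] out[OF True] by (intro mult_right_mono) auto
        finally show ?thesis .
      qed (simp add: w_def)
    qed
    finally show "laplacian_form G f \<le> (real ?k + 3) * (\<Sum>v\<in>pverts G. (f v)\<^sup>2)"
      by (simp add: sum_distrib_left)
  qed
  then show ?thesis using us distinct_card[of us] by simp
qed

text \<open>Every edge not inside \<open>C\<close> joins an outer vertex to \<open>v0\<close>.
  Requiring \<open>f u = f v0\<close> for all outer \<open>u\<close> makes these edges free; the
  others charge each vertex of \<open>C\<close> at most twice, each time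
  \<open>2 (f u)^2\<close>.\<close>

lemma num_laplacian_eigenvalues_le_if_pendants:
  assumes vs: "distinct vs" "set vs = pverts G"
    and C: "C \<subseteq> pverts G" "\<And>v. v \<in> C \<Longrightarrow> card (nbrs G v \<inter> C) \<le> 2"
    and v0: "v0 \<in> C" "\<And>u. u \<in> pverts G - C \<Longrightarrow> nbrs G u \<subseteq> {v0}"
    and t: "4 \<le> t"
  shows "num_laplacian_eigenvalues G vs {t<..b} \<le> card (pverts G - C)"
proof -
  obtain us where us: "set us = pverts G - C" "distinct us"
    using finite_distinct_list pair_finite_verts by (meson finite_Diff)
  have "num_laplacian_eigenvalues G vs {t<..b}
      \<le> length (map (\<lambda>u v. of_bool (v = u) - of_bool (v = v0) :: real) us)"
  proof (rule num_laplacian_eigenvalues_le_codim[OF vs])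
    fix f :: "'a \<Rightarrow> real"
    assume orth: "\<And>c. c \<in> set (map (\<lambda>u v. of_bool (v = u) - of_bool (v = v0)) us) \<Longrightarrow>
      (\<Sum>v\<in>pverts G. c v * f v) = 0"
    have f0: "f u = f v0" if "u \<in> pverts G" "u \<notin> C" for u
    proof -
      have "(\<Sum>v\<in>pverts G. (of_bool (v = u) - of_bool (v = v0)) * f v) = 0"
        by (rule orth) (use that us in auto)
      moreover have "(\<Sum>v\<in>pverts G. (of_bool (v = u) - of_bool (v = v0)) * f v) =
          (\<Sum>v\<in>pverts G. if v = u then f v else 0) - (\<Sum>v\<in>pverts G. if v = v0 then f v else 0)"
        unfolding sum_subtractf[symmetric] by (intro sum.cong) auto
      ultimately show ?thesis using that C(1) v0(1) pair_finite_verts by auto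
    qed
    define w where "w = (\<lambda>u v. if u \<in> C \<and> v \<in> C then 2 * (f u)\<^sup>2 else 0)"
    have "laplacian_form G f \<le> (\<Sum>u\<in>pverts G. \<Sum>v\<in>nbrs G u. w u v)"
    proof (rule laplacian_form_le)
      fix u v assume uv: "(u, v) \<in> parcs G"
      then have "u \<in> pverts G" "v \<in> pverts G" "v \<in> nbrs G u" "u \<in> nbrs G v"
        by (auto simp: nbrs_def dest: in_arcsD1 in_arcsD2 arcs_symmetric)
      then have "f u = f v" if "u \<notin> C \<or> v \<notin> C"
        using that v0(2)[of u] v0(2)[of v] f0[of u] f0[of v] by auto
      then show "(f u - f v)\<^sup>2 \<le> w u v + w v u"
        using diff_square_le[of "f u" "f v"] by (auto simp: w_def)
    qed
    also have "\<dots> \<le> (\<Sum>u\<in>pverts G. t * (f u)\<^sup>2)"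
    proof (rule sum_mono)
      fix u assume "u \<in> pverts G"
      show "(\<Sum>v\<in>nbrs G u. w u v) \<le> t * (f u)\<^sup>2"
      proof (cases "u \<in> C")
        case True
        have "(\<Sum>v\<in>nbrs G u. w u v) = (\<Sum>v\<in>nbrs G u \<inter> C. w u v) + (\<Sum>v\<in>nbrs G u - C. w u v)"
          by (rule sum.Int_Diff) simp
        also have "\<dots> = real (2 * card (nbrs G u \<inter> C)) * (f u)\<^sup>2"
          using True by (simp add: w_def)
        also have "\<dots> \<le> t * (f u)\<^sup>2"
          using C(2)[OF True] t by (intro mult_right_mono) auto
        finally show ?thesis .
      qed (use t in \<open>simp add: w_def\<close>)
    qed
    finally show "laplacian_form G f \<le> t * (\<Sum>v\<in>pverts G. (f v)\<^sup>2)"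
      by (simp add: sum_distrib_left)
  qed
  then show ?thesis using us distinct_card[of us] by simp
qed

text \<open>Every edge joins \<open>{a, c}\<close> to the rest \<open>W\<close>. When
  \<open>f c = - f a\<close>, the at most two edges at \<open>u\<close> in \<open>W\<close> cost at
  most \<open>(f u - f a)^2 + (f u + f a)^2\<close>, in which the mixed terms cancel.\<close>

lemma num_laplacian_eigenvalues_le_1_if_sub_K2m:
  assumes vs: "distinct vs" "set vs = pverts G"
    and ac: "a \<in> pverts G" "c \<in> pverts G" "a \<noteq> c" "(a, c) \<notin> parcs G"
    and bip: "\<And>u. u \<in> pverts G - {a, c} \<Longrightarrow> nbrs G u \<subseteq> {a, c}"
    and t: "2 \<le> t" "real (card (pverts G)) - 2 \<le> t"
  shows "num_laplacian_eigenvalues G vs {t<..b} \<le> 1"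
proof -
  have "num_laplacian_eigenvalues G vs {t<..b} \<le> length [\<lambda>v. of_bool (v = a) + of_bool (v = c) :: real]"
  proof (rule num_laplacian_eigenvalues_le_codim[OF vs])
    fix f :: "'a \<Rightarrow> real"
    assume "\<And>h. h \<in> set [\<lambda>v. of_bool (v = a) + of_bool (v = c)] \<Longrightarrow> (\<Sum>v\<in>pverts G. h v * f v) = 0"
    then have "(\<Sum>v\<in>pverts G. (of_bool (v = a) + of_bool (v = c)) * f v) = 0" by simp
    moreover have "(\<Sum>v\<in>pverts G. (of_bool (v = a) + of_bool (v = c)) * f v) =
        (\<Sum>v\<in>pverts G. if v = a then f v else 0) + (\<Sum>v\<in>pverts G. if v = c then f v else 0)"
      unfolding sum.distrib[symmetric] by (intro sum.cong) auto
    ultimately have fc: "f c = - f a" using ac pair_finite_verts by auto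
    define W where "W = pverts G - {a, c}"
    have W: "finite W" "pverts G = insert a (insert c W)" "a \<notin> W" "c \<notin> W"
      using ac pair_finite_verts by (auto simp: W_def)
    then have card_W: "real (card W) = real (card (pverts G)) - 2"
      using ac(3) by simp
    \<comment> \<open>The end in \<open>W\<close> pays for the whole edge.\<close>
    define w where "w = (\<lambda>u v. if u \<in> W then (f u - f v)\<^sup>2 else 0)"
    have "laplacian_form G f \<le> (\<Sum>u\<in>pverts G. \<Sum>v\<in>nbrs G u. w u v)"
    proof (rule laplacian_form_le)
      fix u v assume uv: "(u, v) \<in> parcs G"
      then have "u \<in> pverts G" "v \<in> pverts G" "u \<noteq> v" "(v, u) \<in> parcs G"
        by (auto dest: in_arcsD1 in_arcsD2 no_loops' arcs_symmetric)
      then have "u \<in> W \<or> v \<in> W" using uv ac(4) by (auto simp: W_def)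
      then show "(f u - f v)\<^sup>2 \<le> w u v + w v u"
        by (auto simp: w_def power2_commute)
    qed
    also have "\<dots> = (\<Sum>u\<in>W. \<Sum>v\<in>nbrs G u. (f u - f v)\<^sup>2)"
      using W ac(3) by (simp add: w_def)
    also have "\<dots> \<le> (\<Sum>u\<in>W. 2 * (f u)\<^sup>2 + 2 * (f a)\<^sup>2)"
    proof (rule sum_mono)
      fix u assume "u \<in> W"
      then have "(\<Sum>v\<in>nbrs G u. (f u - f v)\<^sup>2) \<le> (\<Sum>v\<in>{a, c}. (f u - f v)\<^sup>2)"
        using bip[of u] by (intro sum_mono2) (auto simp: W_def)
      also have "\<dots> = 2 * (f u)\<^sup>2 + 2 * (f a)\<^sup>2"
        using ac(3) by (simp add: fc power2_eq_square algebra_simps)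
      finally show "(\<Sum>v\<in>nbrs G u. (f u - f v)\<^sup>2) \<le> 2 * (f u)\<^sup>2 + 2 * (f a)\<^sup>2" .
    qed
    also have "\<dots> = 2 * (\<Sum>u\<in>W. (f u)\<^sup>2) + real (card W) * (2 * (f a)\<^sup>2)"
      by (simp add: sum.distrib sum_distrib_left)
    \<comment> \<open>The bound \<open>2 \<le> t\<close> serves the vertices of \<open>W\<close>,
      and \<open>card W \<le> t\<close> serves \<open>a\<close> and \<open>c\<close>, whose squares
      sum to \<open>2 (f a)^2\<close>.\<close>
    also have "\<dots> \<le> t * (\<Sum>u\<in>W. (f u)\<^sup>2) + t * (2 * (f a)\<^sup>2)"
      using t card_W by (intro add_mono mult_right_mono sum_nonneg) auto
    also have "\<dots> = t * (\<Sum>v\<in>pverts G. (f v)\<^sup>2)"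
      using W ac(3) by (simp add: fc algebra_simps)
    finally show "laplacian_form G f \<le> t * (\<Sum>v\<in>pverts G. (f v)\<^sup>2)" .
  qed
  then show ?thesis by simp
qed

lemma shortest_cycle_eigenvalue_bound:
  assumes vs: "distinct vs" "set vs = pverts G"
    and c: "cyclic_list G xs" "length xs = girth G" and g: "4 \<le> girth G"
    and non_cycle: "\<not> is_cycle_graph G"
  shows "num_laplacian_eigenvalues G vs {real (card (pverts G - set xs)) + 3<..r}
    \<le> card (pverts G - set xs)"
proof -
  let ?C = "set xs"
  let ?k = "card (pverts G - ?C)"
  have C: "?C \<subseteq> pverts G" using c(1) by (rule cyclic_list_verts)
  note deg = card_nbrs_on_shortest_cycle[OF c]
  have "pverts G - ?C \<noteq> {}"
    using spanning_shortest_cycle_imp_cycle_graph[OF c] non_cycle C by blast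
  then have k: "1 \<le> ?k"
    using pair_finite_verts by (simp add: Suc_le_eq card_gt_0_iff)
  show ?thesis
  proof (cases "\<forall>v\<in>?C. card (nbrs G v - ?C) < ?k")
    case True
    then show ?thesis
      using num_laplacian_eigenvalues_le_if_few_outer_nbrs[OF vs C deg] by blast
  next
    case False
    then obtain a where a: "a \<in> ?C" "?k \<le> card (nbrs G a - ?C)" by force
    \<comment> \<open>A subset of the outer vertices with at least as many elements is all of
      them.\<close>
    have outer: "nbrs G a - ?C = pverts G - ?C"
      using a(2) pair_finite_verts nbrs_subset[of a] by (intro card_seteq) auto
    have au: "(a, u) \<in> parcs G" if "u \<in> pverts G - ?C" for u
      using that outer by (auto simp: nbrs_def)
    obtain ys zs where xs: "xs = ys @ a # zs" using a(1) by (auto simp: in_set_conv_decomp)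
    define ws where "ws = zs @ ys"
    have rot: "cyclic_list G (a # ws)" "length (a # ws) = girth G" "set (a # ws) = ?C"
      using c cyclic_list_rotate[of G ys a zs] by (auto simp: xs ws_def)
    \<comment> \<open>Two adjacent outer vertices would form a triangle with
      \<open>a\<close>.\<close>
    have inner: "v \<in> ?C" if u: "u \<in> pverts G - ?C" and v: "v \<in> nbrs G u" for u v
    proof (rule ccontr)
      assume "v \<notin> ?C"
      then have "(a, v) \<in> parcs G" using v nbrs_subset[of u] by (intro au) auto
      then show False using no_triangle[OF g au[OF u]] v by (auto simp: nbrs_def)
    qed
    have opposite: "\<exists>as bs. ws = as @ v # bs \<and> length as \<le> 1 \<and> length bs \<le> 1"
      if u: "u \<in> pverts G - ?C" and v: "v \<in> nbrs G u" "v \<noteq> a" for u v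
      using two_nbrs_on_shortest_cycle[OF rot(1,2), of u v] arcs_symmetric[OF au[OF u]]
        inner[OF u v(1)] u v rot(3) by (auto simp: nbrs_def)
    show ?thesis
    proof (cases "girth G = 4")
      case False
      \<comment> \<open>A second neighbour would leave at most one vertex between it and
        \<open>a\<close> on either side of the cycle, forcing girth at most 4.\<close>
      have "nbrs G u \<subseteq> {a}" if "u \<in> pverts G - ?C" for u
        using opposite[OF that] rot(2) g False by fastforce
      then show ?thesis
        using k by (intro num_laplacian_eigenvalues_le_if_pendants[OF vs C deg a(1)]) auto
    next
      case True
      then have "length ws = Suc (Suc (Suc 0))" using rot(2) by simp
      \<comment> \<open>The cycle is \<open>a, b, e, d\<close>, with \<open>e\<close> opposite to
        \<open>a\<close>.\<close>
      then obtain b e d where ws: "ws = [b, e, d]" by (auto simp: length_Suc_conv)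
      have arcs: "(a, b) \<in> parcs G" "(b, e) \<in> parcs G" "(e, d) \<in> parcs G" "(d, a) \<in> parcs G"
        and dist: "distinct [a, b, e, d]"
        using rot(1) by (auto simp: ws cyclic_list_def)
      have C4: "?C = {a, b, e, d}" using rot(3) ws by auto
      have ad: "(a, d) \<in> parcs G" using arcs(4) by (rule arcs_symmetric)
      have ae: "(a, e) \<notin> parcs G" using no_triangle[OF g arcs(1,2)] .
      \<comment> \<open>Without triangles a neighbour \<open>v\<close> of \<open>u\<close> is not
        adjacent to \<open>a\<close>. It thus lies on the cycle, as all outer vertices are adjacent
        to \<open>a\<close>, and differs from \<open>b\<close> and \<open>d\<close>.\<close>
      have nbr_of_nbr: "nbrs G u \<subseteq> {a, e}" if u: "(a, u) \<in> parcs G" "u \<in> {b, d}" for u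
      proof
        fix v assume "v \<in> nbrs G u"
        then have uv: "(u, v) \<in> parcs G" by (simp add: nbrs_def)
        then have "(a, v) \<notin> parcs G" using no_triangle[OF g u(1)] by blast
        then have "v \<in> ?C" using au[of v] uv by (auto dest: in_arcsD2)
        then show "v \<in> {a, e}" using \<open>(a, v) \<notin> parcs G\<close> arcs(1) ad C4 by auto
      qed
      have outer_nbrs: "nbrs G u \<subseteq> {a, e}" if "u \<in> pverts G - ?C" for u
      proof
        fix v assume v: "v \<in> nbrs G u"
        show "v \<in> {a, e}"
        proof (cases "v = a")
          case False
          \<comment> \<open>At most one vertex on either side of \<open>v\<close> in
            \<open>[b, e, d]\<close> leaves only the middle one.\<close>
          then obtain as bs where "ws = as @ v # bs" "length as \<le> 1" "length bs \<le> 1"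
            using opposite[OF \<open>u \<in> pverts G - ?C\<close> v] by blast
          then show ?thesis by (cases as; cases bs) (auto simp: ws)
        qed simp
      qed
      have card: "?k = card (pverts G) - 4"
        using C pair_finite_verts dist by (simp add: card_Diff_subset C4)
      \<comment> \<open>The threshold is \<open>n - 1\<close> for \<open>n\<close> vertices, so it
        covers the required \<open>n - 2\<close>; a count of 1 suffices because \<open>?k\<close> is
        positive.\<close>
      have "num_laplacian_eigenvalues G vs {real ?k + 3<..r} \<le> 1"
      proof (rule num_laplacian_eigenvalues_le_1_if_sub_K2m[OF vs])
        show "a \<in> pverts G" "e \<in> pverts G" "a \<noteq> e" using C C4 dist by auto
        show "nbrs G u \<subseteq> {a, e}" if "u \<in> pverts G - {a, e}" for u
          using that nbr_of_nbr[of b] nbr_of_nbr[of d] arcs(1) ad outer_nbrs[of u] C4 by blast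
        show "real (card (pverts G)) - 2 \<le> real ?k + 3" using card by simp
      qed (use ae in auto)
      then show ?thesis using k by linarith
    qed
  qed
qed

end

theorem theorem3p1:
  fixes G :: "'a pair_pre_digraph" and vs :: "'a list" and n g :: nat
  assumes "pair_graph G"
    and "Digraph_Component.connected (with_proj G)"
    and "distinct vs" and "set vs = pverts G"
    and "n = card (pverts G)"
    and "\<exists>p. graph_cycle G p"
    and "g = girth G"
    and "\<not> is_cycle_graph G"
  shows "int (num_laplacian_eigenvalues G vs {real n - real g + 3 <.. real n}) \<le> int n - int g"
proof -
  interpret pair_graph G by fact
  obtain xs where xs: "cyclic_list G xs" "length xs = girth G"
    using exists_shortest_cyclic_list assms by blast
  have C: "set xs \<subseteq> pverts G" using xs(1) by (rule cyclic_list_verts)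
  have "card (set xs) = g" "3 \<le> g"
    using xs assms(7) by (auto simp: cyclic_list_def distinct_card)
  \<comment> \<open>With \<open>g \<le> n\<close> the natural number \<open>n - g\<close> agrees
    with the real and integer differences in the claim.\<close>
  then have le: "g \<le> n" and k: "card (pverts G - set xs) = n - g"
    using C card_mono[OF pair_finite_verts C] assms(5) by (auto simp: card_Diff_subset)
  show ?thesis
  proof (cases "g = 3")
    case True
    then show ?thesis using le by (simp add: num_laplacian_eigenvalues_def)
  next
    case False
    then have "num_laplacian_eigenvalues G vs {real (n - g) + 3<..real n} \<le> n - g"
      using shortest_cycle_eigenvalue_bound[OF assms(3,4) xs _ assms(8)] \<open>3 \<le> g\<close> assms(7) k by simp
    then show ?thesis using le by (simp add: of_nat_diff)
  qed
qed

end
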